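(* Let $k,m\in\mathbb{N}_0$ with $k/2<m\le k$, and let $x>0$, $x\ne1$. Then $$\sum_{n=0}^{k}\frac{2^n\,\mathfrak{p}_n\left(\frac{m-k}{2},-2m,1\right)}{(k-n)!}\,(x-1)^n\left|\frac{1+x}{1-x}\right|^{\frac n2}P_{k-n}^{m-n}(x)=0.$$
   Context: $\mathbb{N}_0=\{0,1,2,\dots\}$. The polynomials $\mathfrak{p}_n(\rho,\tau,t)$ are defined by $$(1-zt)^{-\rho}\left(1+\sqrt{1-z}\right)^{-\tau}=2^{-\tau}\sum_{n=0}^\infty\mathfrak{p}_n(\rho,\tau,t)\,z^n\qquad(|z|\text{ small}).$$ For $\mu,\nu\in\mathbb{C}$ and real $x>-1$, $x\ne1$, $$P_\nu^{-\mu}(x)=\left|\frac{1-x}{1+x}\right|^{\mu/2}\frac{F\left(-\nu,\nu+1;1+\mu;\frac{1-x}{2}\right)}{\Gamma(1+\mu)},$$ where $F(a,b;c;t)$ is the Gauss hypergeometric function and $F(a,b;c;t)/\Gamma(c)$ is understood as the regularized function, entire in $a,b,c$. For integer degree $k\ge0$ and integer order (positive or negative) these are the associated Legendre polynomials. *)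

theory Defs
  imports "HOL-Complex_Analysis.Complex_Analysis"
begin

(* Principal branches throughout; for every t the function expanded is
   holomorphic near z = 0, because 1 - z * t is near 1 and 1 + csqrt (1 - z) is near 2. *)
definition frakp :: "nat \<Rightarrow> complex \<Rightarrow> complex \<Rightarrow> complex \<Rightarrow> complex" where
  "frakp n \<rho> \<tau> t = 2 powr \<tau> *
     fps_nth (fps_expansion
       (\<lambda>z. (1 - z * t) powr (- \<rho>) * (1 + csqrt (1 - z)) powr (- \<tau>)) 0) n"

(* The series of F(a,b;c;z) / Gamma(c).  Dividing termwise gives 1 / Gamma(c + n), which is
   entire in c (and zero at the poles of Gamma), so c may be a nonpositive integer. *)
definition reg_hypergeo_series :: "complex \<Rightarrow> complex \<Rightarrow> complex \<Rightarrow> complex \<Rightarrow> complex" where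
  "reg_hypergeo_series a b c z =
     (\<Sum>n. pochhammer a n * pochhammer b n * rGamma (c + of_nat n) / fact n * z ^ n)"

definition slit_plane :: "complex set" where
  "slit_plane = - {z. Im z = 0 \<and> 1 \<le> Re z}"

(* Principal branch of the analytic continuation: the series itself only converges on the unit
   disc (unless it terminates), whereas arguments below -1 are needed as well.
   Meaningful for z in slit_plane only. *)
definition reg_hypergeo :: "complex \<Rightarrow> complex \<Rightarrow> complex \<Rightarrow> complex \<Rightarrow> complex" where
  "reg_hypergeo a b c z =
     (THE w. \<exists>f. f holomorphic_on slit_plane \<and>
                 (\<forall>u\<in>ball 0 1. f u = reg_hypergeo_series a b c u) \<and> f z = w)"

(* The second argument is the upper index (the order), so the function usually written with
   upper index -mu is legendreP nu (-mu).  Meaningful for x > -1 with x distinct from 1. *)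
definition legendreP :: "complex \<Rightarrow> complex \<Rightarrow> real \<Rightarrow> complex" where
  "legendreP \<nu> \<sigma> x =
     of_real \<bar>(1 - x) / (1 + x)\<bar> powr (- \<sigma> / 2) *
     reg_hypergeo (- \<nu>) (\<nu> + 1) (1 - \<sigma>) (of_real ((1 - x) / 2))"

end

theory Submission
  imports Defs
begin

text \<open>
  All the Legendre functions in the sum have a nonnegative integer degree, so their hypergeometric
  series terminate, and the powers of \<open>\<bar>(1 - x) / (1 + x)\<bar>\<close> combine to an exponent that does not depend
  on \<open>n\<close>. With \<open>u = (1 - x) / 2\<close>, what remains is a polynomial in \<open>u\<close>. Collecting the
  terms with \<open>u ^ s\<close>, its coefficient is, up to sign,
  \<open>rGamma (1 - m + s) / fact (k - s)\<close> times
  \<open>\<Sum>n\<le>s. 4 ^ n * p n * ((k - n + (s - n)) choose (s - n))\<close>,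
  where \<open>p n\<close> are the coefficients \<open>frakp\<close> with the parameters of the theorem. For \<open>s < m\<close> the
  reciprocal Gamma factor is zero; for \<open>m \<le> s \<le> k\<close> the binomial sum is zero.

  The latter is seen by the substitution \<open>z = 4 * y * (1 - y)\<close>, which makes
  \<open>sqrt (1 - z) = 1 - 2 * y\<close> rational and turns the generating function of \<open>p\<close> into the polynomial
  \<open>(1 - 2 * y) ^ (k - m) * (1 - y) ^ (2 * m)\<close> (lemma \<open>frakp_fps_compose\<close>).
  On the other hand, the binomial coefficient is the coefficient of \<open>y ^ s\<close> in
  \<open>(y * (1 - y)) ^ n / (1 - y) ^ (k + 1)\<close>. Hence the binomial sum is the coefficient of
  \<open>y ^ s\<close> in the substituted generating function divided by \<open>(1 - y) ^ (k + 1)\<close>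
  (lemma \<open>fps_compose_quadratic_nth\<close>). The hypothesis \<open>k < 2 * m\<close> makes this quotient the polynomial
  \<open>(1 - 2 * y) ^ (k - m) * (1 - y) ^ (2 * m - k - 1)\<close>, whose degree \<open>m - 1\<close> is less than \<open>s\<close>
  (lemma \<open>frakp_binomial_sum_eq_0\<close>).
\<close>

section \<open>The hypergeometric function with a terminating series\<close>

lemma open_slit_plane: "open slit_plane"
proof -
  have "closed {z::complex. Im z = 0 \<and> 1 \<le> Re z}"
    by (intro closed_Collect_conj closed_Collect_eq closed_Collect_le continuous_intros)
  then show ?thesis by (simp add: slit_plane_def open_Compl)
qed

text \<open>Connectedness is what makes the analytic continuation to the slit plane unique.\<close>

lemma connected_slit_plane: "connected slit_plane"
proof (rule starlike_imp_connected)
  show "starlike slit_plane"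
    unfolding starlike_def
  proof (intro bexI[of _ 0] ballI subsetI)
    fix z w :: complex assume z: "z \<in> slit_plane" and "w \<in> closed_segment 0 z"
    then obtain t where t: "0 \<le> t" "t \<le> 1" "w = t *\<^sub>R z"
      by (auto simp: in_segment)
    have "\<not> (Im w = 0 \<and> 1 \<le> Re w)"
    proof
      assume *: "Im w = 0 \<and> 1 \<le> Re w"
      then have "t \<noteq> 0" "Im z = 0" using t by auto
      moreover have "1 \<le> Re z"
      proof (rule ccontr)
        assume "\<not> 1 \<le> Re z"
        then have "t * Re z < t * 1" using t \<open>t \<noteq> 0\<close> by (intro mult_strict_left_mono) auto
        then show False using * t by simp
      qed
      ultimately show False using z by (simp add: slit_plane_def)
    qed
    then show "w \<in> slit_plane" by (simp add: slit_plane_def)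
  qed (simp add: slit_plane_def)
qed

lemma reg_hypergeo_series_terminating:
  "reg_hypergeo_series (- of_nat N) b c z =
     (\<Sum>j\<le>N. pochhammer (- of_nat N) j * pochhammer b j * rGamma (c + of_nat j) / fact j * z ^ j)"
  unfolding reg_hypergeo_series_def
  by (rule suminf_finite) (auto simp: pochhammer_of_nat_eq_0_iff)

text \<open>
  A terminating series is a polynomial, hence it is its own analytic continuation; the identity
  theorem rules out any other value.
\<close>

lemma reg_hypergeo_terminating:
  assumes "z \<in> slit_plane"
  shows "reg_hypergeo (- of_nat N) b c z = reg_hypergeo_series (- of_nat N) b c z"
  unfolding reg_hypergeo_def
proof (rule the_equality)
  let ?h = "reg_hypergeo_series (- of_nat N) b c"
  have hol: "?h holomorphic_on slit_plane"
    unfolding reg_hypergeo_series_terminating by (intro holomorphic_intros) auto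
  then show "\<exists>f. f holomorphic_on slit_plane \<and> (\<forall>u\<in>ball 0 1. f u = ?h u) \<and> f z = ?h z"
    by blast
  have ball: "ball 0 1 \<subseteq> slit_plane"
  proof
    fix v :: complex assume "v \<in> ball 0 1"
    then have "Re v < 1" using complex_Re_le_cmod[of v] by simp
    then show "v \<in> slit_plane" by (simp add: slit_plane_def)
  qed
  fix w assume "\<exists>f. f holomorphic_on slit_plane \<and> (\<forall>u\<in>ball 0 1. f u = ?h u) \<and> f z = w"
  then obtain f where f: "f holomorphic_on slit_plane" "\<forall>u\<in>ball 0 1. f u = ?h u" "f z = w"
    by blast
  have "f z = ?h z"
    by (rule analytic_continuation_open[of "ball 0 1" slit_plane f ?h])
       (use f hol ball assms open_slit_plane connected_slit_plane in auto)
  then show "w = ?h z" using f by simp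
qed

text \<open>
  The division by \<open>fact N\<close> turns \<open>pochhammer (- N) j * pochhammer (N + 1) j / fact j\<close> into a binomial
  coefficient over \<open>fact (N - j)\<close>. For \<open>N = k - n\<close> the latter depends only on \<open>n + j\<close>, as does
  \<open>rGamma (1 - \<sigma> + j)\<close> for \<open>\<sigma> = m - n\<close>; both can then be pulled out of a sum over constant \<open>n + j\<close>.
\<close>

lemma legendreP_of_nat:
  assumes "x > - 1"
  shows "legendreP (of_nat N) \<sigma> x / fact N =
     of_real \<bar>(1 - x) / (1 + x)\<bar> powr (- \<sigma> / 2) *
     (\<Sum>j\<le>N. (- 1) ^ j * of_nat ((N + j) choose j) / fact (N - j) *
              rGamma (1 - \<sigma> + of_nat j) * of_real ((1 - x) / 2) ^ j)"
proof -
  have "complex_of_real ((1 - x) / 2) \<in> slit_plane"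
    using assms by (simp only: slit_plane_def Compl_iff mem_Collect_eq Im_complex_of_real Re_complex_of_real) simp
  moreover have "pochhammer (- of_nat N :: complex) j * pochhammer (of_nat N + 1) j / fact j / fact N =
      (- 1) ^ j * of_nat ((N + j) choose j) / fact (N - j)" if "j \<le> N" for j
  proof -
    have 1: "of_nat (N choose j) = (- 1) ^ j * pochhammer (- of_nat N :: complex) j / fact j"
      by (simp add: gbinomial_pochhammer binomial_gbinomial)
    have 2: "of_nat ((N + j) choose j) = pochhammer (of_nat N + 1 :: complex) j / fact j"
      by (simp add: gbinomial_pochhammer' binomial_gbinomial)
    have 3: "(of_nat (N choose j) :: complex) = fact N / (fact j * fact (N - j))"
      by (rule binomial_fact[OF that])
    have "(- 1) ^ j * ((- 1) ^ j * pochhammer (- of_nat N :: complex) j) = pochhammer (- of_nat N) j"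
      by (simp flip: mult.assoc power_mult_distrib)
    then have "pochhammer (- of_nat N :: complex) j = (- 1) ^ j * (fact N / fact (N - j))"
      using 1 3 by (simp add: field_simps)
    with 2 show ?thesis by simp
  qed
  ultimately show ?thesis
    unfolding legendreP_def
    by (subst reg_hypergeo_terminating)
       (auto simp: reg_hypergeo_series_terminating sum_divide_distrib sum_distrib_left field_simps
             intro!: sum.cong)
qed

section \<open>The generating function\<close>

text \<open>
  Since \<open>1 - 4 * y * (1 - y) = (1 - 2 * y)\<^sup>2\<close>, and \<open>1 - 2 * y\<close> has positive real part for small \<open>y\<close>,
  the principal square root of the left-hand side is \<open>1 - 2 * y\<close>, and one plus this root is
  \<open>2 * (1 - y)\<close>. So the composition of the defining function with \<open>4 * y * (1 - y)\<close> is a polynomial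
  near \<open>0\<close>, and the expansions of the two agree.
\<close>

lemma frakp_fps_compose:
  fixes a b :: nat
  shows "Abs_fps (\<lambda>n. frakp n (- of_nat a / 2) (- of_nat b) 1) oo (fps_const 4 * (fps_X * (1 - fps_X))) =
         (1 - fps_const 2 * fps_X) ^ a * (1 - fps_X) ^ b"
proof (rule fps_expansion_unique_complex)
  define g where "g = (\<lambda>z::complex. (1 - z * 1) powr (- (- of_nat a / 2)) * (1 + csqrt (1 - z)) powr (- (- of_nat b)))"
  have "g holomorphic_on ball 0 1"
    unfolding g_def
  proof (intro holomorphic_intros)
    fix z :: complex assume "z \<in> ball 0 1"
    then have "Re z < 1" using complex_Re_le_cmod[of z] by simp
    then show "1 - z * 1 \<notin> \<real>\<^sub>\<le>\<^sub>0" "1 - z \<notin> \<real>\<^sub>\<le>\<^sub>0"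
      by (auto simp: complex_nonpos_Reals_iff)
    have "Re (csqrt (1 - z)) \<ge> 0" using csqrt_principal[of "1 - z"] by auto
    then show "1 + csqrt (1 - z) \<notin> \<real>\<^sub>\<le>\<^sub>0"
      by (auto simp: complex_nonpos_Reals_iff simp del: csqrt.sel)
  qed
  then have "g has_fps_expansion fps_expansion g 0"
    by (intro has_fps_expansion_fps_expansion[of "ball 0 1"]) auto
  then have "(\<lambda>z. 2 powr (- of_nat b) * g z) has_fps_expansion
               fps_const (2 powr (- of_nat b)) * fps_expansion g 0"
    by (intro fps_expansion_intros)
  also have "fps_const (2 powr (- of_nat b)) * fps_expansion g 0 =
               Abs_fps (\<lambda>n. frakp n (- of_nat a / 2) (- of_nat b) 1)"
    by (simp add: fps_eq_iff frakp_def g_def)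
  finally have P: "(\<lambda>z. 2 powr (- of_nat b) * g z) has_fps_expansion
                      Abs_fps (\<lambda>n. frakp n (- of_nat a / 2) (- of_nat b) 1)" .
  have Q: "(\<lambda>y. 4 * (y * (1 - y))) has_fps_expansion (fps_const 4 * (fps_X * (1 - fps_X)) :: complex fps)"
    by (intro fps_expansion_intros)
  show "((\<lambda>z. 2 powr (- of_nat b) * g z) \<circ> (\<lambda>y. 4 * (y * (1 - y)))) has_fps_expansion
      (Abs_fps (\<lambda>n. frakp n (- of_nat a / 2) (- of_nat b) 1) oo (fps_const 4 * (fps_X * (1 - fps_X))))"
    by (rule has_fps_expansion_compose[OF P Q]) simp
  have "(\<lambda>y. (1 - 2 * y) ^ a * (1 - y) ^ b) has_fps_expansion
      ((1 - fps_const 2 * fps_X) ^ a * (1 - fps_X) ^ b :: complex fps)"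
    by (intro fps_expansion_intros)
  moreover have "eventually (\<lambda>y. y \<in> ball 0 (1/2)) (nhds (0::complex))"
    by (intro eventually_nhds_in_open) auto
  then have "eventually (\<lambda>y. (1 - 2 * y) ^ a * (1 - y) ^ b =
               ((\<lambda>z. 2 powr (- of_nat b) * g z) \<circ> (\<lambda>y. 4 * (y * (1 - y)))) y) (nhds 0)"
  proof eventually_elim
    case (elim y)
    define r where "r = 1 - 2 * y"
    have "Re y < 1 / 2" using elim complex_Re_le_cmod[of y] by simp
    then have r: "Re r > 0" by (simp add: r_def)
    then have "r \<noteq> 0" by auto
    have sq: "1 - 4 * (y * (1 - y)) = r ^ 2" by (simp add: r_def power2_eq_square algebra_simps)
    have cs: "csqrt (r ^ 2) = r" using r by (simp add: csqrt_square)
    have "r ^ a = exp (Ln (r ^ 2) / 2) ^ a"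
      using csqrt_exp_Ln[of "r ^ 2"] \<open>r \<noteq> 0\<close> by (simp add: cs)
    also have "\<dots> = exp (of_nat a * (Ln (r ^ 2) / 2))"
      by (rule exp_of_nat_mult[symmetric])
    also have "\<dots> = (r ^ 2) powr (of_nat a / 2)"
      using \<open>r \<noteq> 0\<close> by (simp add: powr_def)
    finally have A: "(r ^ 2) powr (of_nat a / 2) = r ^ a" by (rule sym)
    have "1 + r = 2 * (1 - y)" by (simp add: r_def)
    moreover have "1 + r \<noteq> 0" using r by (auto simp: complex_eq_iff)
    ultimately have B: "(1 + r) powr of_nat b = 2 ^ b * (1 - y) ^ b"
      by (metis powr_nat' power_mult_distrib)
    have C: "(2::complex) powr (- of_nat b) = inverse (2 ^ b)"
      by (simp add: powr_minus powr_nat')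
    show ?case
      by (simp add: g_def sq cs A B C) (simp add: r_def)
  qed
  ultimately show "((\<lambda>z. 2 powr (- of_nat b) * g z) \<circ> (\<lambda>y. 4 * (y * (1 - y)))) has_fps_expansion
      (1 - fps_const 2 * fps_X) ^ a * (1 - fps_X) ^ b"
    by (subst (asm) has_fps_expansion_cong[OF _ refl])
qed

section \<open>A binomial sum as a coefficient\<close>

text \<open>
  Coefficient extraction from \<open>\<Sum>n. A $ n * B ^ n * C\<close>; the sum stops at \<open>s\<close> because \<open>B ^ n\<close> starts
  at degree \<open>n\<close> or later.
\<close>

lemma fps_compose_mult_nth:
  fixes A B C :: "'a :: field_char_0 fps"
  assumes "B $ 0 = 0"
  shows "((A oo B) * C) $ s = (\<Sum>n\<le>s. A $ n * (B ^ n * C) $ s)"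
proof -
  have extend: "(\<Sum>n\<le>i. A $ n * (B ^ n) $ i) = (\<Sum>n\<le>s. A $ n * (B ^ n) $ i)" if "i \<le> s" for i
    using that startsby_zero_power_prefix[OF assms] by (intro sum.mono_neutral_left) auto
  have "((A oo B) * C) $ s = (\<Sum>i\<le>s. (\<Sum>n\<le>i. A $ n * (B ^ n) $ i) * C $ (s - i))"
    by (simp add: fps_mult_nth fps_compose_nth atLeast0AtMost)
  also have "\<dots> = (\<Sum>i\<le>s. (\<Sum>n\<le>s. A $ n * (B ^ n) $ i) * C $ (s - i))"
    using extend by simp
  also have "\<dots> = (\<Sum>n\<le>s. \<Sum>i\<le>s. A $ n * (B ^ n) $ i * C $ (s - i))"
    unfolding sum_distrib_right by (rule sum.swap)
  also have "\<dots> = (\<Sum>n\<le>s. A $ n * (B ^ n * C) $ s)"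
    by (simp add: fps_mult_nth sum_distrib_left mult.assoc atLeast0AtMost)
  finally show ?thesis .
qed

text \<open>
  For \<open>n \<le> k\<close>, the coefficient of \<open>y ^ s\<close> in \<open>(y * (1 - y)) ^ n / (1 - y) ^ (k + 1)\<close> is that of
  \<open>y ^ (s - n)\<close> in the negative binomial series \<open>1 / (1 - y) ^ (k - n + 1)\<close>. The bound \<open>s \<le> k\<close> makes this
  apply to every \<open>n\<close> that contributes.
\<close>

lemma fps_compose_quadratic_nth:
  fixes A :: "'a :: field_char_0 fps"
  assumes "s \<le> k"
  shows "((A oo (fps_const c * (fps_X * (1 - fps_X)))) * inverse ((1 - fps_X) ^ Suc k)) $ s =
         (\<Sum>n\<le>s. c ^ n * A $ n * of_nat ((k - n + (s - n)) choose (s - n)))"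
proof (subst fps_compose_mult_nth, simp, intro sum.cong refl)
  fix n assume n: "n \<in> {..s}"
  let ?u = "1 - fps_X :: 'a fps"
  have "?u ^ Suc k = ?u ^ n * ?u ^ Suc (k - n)"
    using n assms by (simp flip: power_add power_Suc)
  then have "?u ^ n * inverse (?u ^ Suc k) = (?u ^ n * inverse (?u ^ n)) * inverse (?u ^ Suc (k - n))"
    by (simp only: fps_inverse_mult mult.assoc)
  also have "?u ^ n * inverse (?u ^ n) = 1"
    by (subst mult.commute, rule inverse_mult_eq_1) (simp add: fps_power_zeroth)
  finally have *: "?u ^ n * inverse (?u ^ Suc k) = inverse (?u ^ Suc (k - n))" by simp
  have "(fps_const c * (fps_X * ?u)) ^ n * inverse (?u ^ Suc k) =
        fps_const (c ^ n) * (fps_X ^ n * (?u ^ n * inverse (?u ^ Suc k)))"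
    by (simp only: power_mult_distrib fps_const_power mult.assoc)
  then have "(fps_const c * (fps_X * ?u)) ^ n * inverse (?u ^ Suc k) =
        fps_const (c ^ n) * (fps_X ^ n * inverse (?u ^ Suc (k - n)))"
    by (simp only: *)
  moreover have "inverse (?u ^ Suc (k - n)) $ (s - n) = of_nat ((k - n + (s - n)) choose (s - n))"
    using one_minus_const_fps_X_neg_power'[of "Suc (k - n)" "1 :: 'a"] by simp
  ultimately show "A $ n * ((fps_const c * (fps_X * ?u)) ^ n * inverse (?u ^ Suc k)) $ s =
      c ^ n * A $ n * of_nat ((k - n + (s - n)) choose (s - n))"
    using n by (simp add: fps_X_power_mult_nth del: power_Suc)
qed

text \<open>
  The sum is a coefficient of \<open>(1 - 2 * y) ^ a * (1 - y) ^ b / (1 - y) ^ (k + 1)\<close>. Here \<open>k < b\<close> says that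
  this is a polynomial, and \<open>a + b \<le> k + s\<close> that its degree \<open>a + b - k - 1\<close> is below \<open>s\<close>.
\<close>

lemma frakp_binomial_sum_eq_0:
  fixes a b k s :: nat
  assumes "s \<le> k" "k < b" "a + b \<le> k + s"
  shows "(\<Sum>n\<le>s. 4 ^ n * frakp n (- of_nat a / 2) (- of_nat b) 1 *
            of_nat ((k - n + (s - n)) choose (s - n))) = 0"
proof -
  let ?u = "1 - fps_X :: complex fps"
  define p :: "complex poly" where "p = [:1, - 2:] ^ a * [:1, - 1:] ^ (b - Suc k)"
  have "degree p \<le> a + (b - Suc k)"
    unfolding p_def
    by (intro order.trans[OF degree_mult_le] add_mono order.trans[OF degree_power_le]) auto
  also have "\<dots> < s" using assms by simp
  finally have deg: "coeff p s = 0" by (rule coeff_eq_0)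
  have b: "?u ^ b = ?u ^ (b - Suc k) * ?u ^ Suc k"
    using assms by (simp flip: power_add power_Suc)
  have inv: "?u ^ Suc k * inverse (?u ^ Suc k) = 1"
    by (subst mult.commute, rule inverse_mult_eq_1) (simp add: fps_power_zeroth del: power_Suc)
  have "(1 - fps_const 2 * fps_X) ^ a * ?u ^ b * inverse (?u ^ Suc k) =
        (1 - fps_const 2 * fps_X) ^ a * ?u ^ (b - Suc k) * (?u ^ Suc k * inverse (?u ^ Suc k))"
    by (simp only: b mult.assoc)
  also have "\<dots> = fps_of_poly p"
    unfolding inv p_def
    by (simp add: fps_of_poly_mult fps_of_poly_power fps_of_poly_pCons numeral_fps_const mult.commute
             flip: fps_const_neg)
  finally have "((1 - fps_const 2 * fps_X) ^ a * ?u ^ b * inverse (?u ^ Suc k)) $ s = 0"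
    using deg by simp
  then show ?thesis
    unfolding frakp_fps_compose[symmetric] fps_compose_quadratic_nth[OF \<open>s \<le> k\<close>] by simp
qed

section \<open>The identity\<close>

theorem corollary12:
  fixes k m :: nat and x :: real
  assumes "real k / 2 < real m" and "m \<le> k"
    and "x > 0" and "x \<noteq> 1"
  shows "(\<Sum>n=0..k.
            2 ^ n * frakp n ((of_nat m - of_nat k) / 2) (- 2 * of_nat m) 1 / fact (k - n)
            * of_real ((x - 1) ^ n)
            * of_real (\<bar>(1 + x) / (1 - x)\<bar> powr (real n / 2))
            * legendreP (of_nat (k - n)) (of_nat m - of_nat n) x) = (0 :: complex)"
proof -
  define A where "A = \<bar>(1 - x) / (1 + x)\<bar>"
  define u where "u = complex_of_real ((1 - x) / 2)"
  define p where "p = (\<lambda>n. frakp n (- of_nat (k - m) / 2) (- of_nat (2 * m)) 1)"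
  define W where "W = complex_of_real A powr (- of_nat m / 2)"
  \<comment> \<open>The second factor depends on \<open>n + j\<close> only.\<close>
  define T where "T = (\<lambda>n j. 4 ^ n * p n * of_nat ((k - n + j) choose j) *
      (W * rGamma (1 - of_nat m + of_nat (n + j)) / fact (k - (n + j)) * (- u) ^ (n + j)))"
  have A: "A > 0" using assms by (auto simp: A_def)
  have p: "frakp n ((of_nat m - of_nat k) / 2) (- 2 * of_nat m) 1 = p n" for n
    using assms by (simp add: p_def of_nat_diff)
  have pref: "of_real (\<bar>(1 + x) / (1 - x)\<bar> powr (real n / 2)) *
      complex_of_real A powr (- (of_nat m - of_nat n) / 2) = W" for n
  proof -
    \<comment> \<open>The given factor contributes the exponent \<open>- n / 2\<close>, which cancels the \<open>n\<close> in the order.\<close>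
    have "\<bar>(1 + x) / (1 - x)\<bar> = inverse A" by (simp add: A_def flip: abs_inverse)
    then have "complex_of_real (\<bar>(1 + x) / (1 - x)\<bar> powr (real n / 2)) = of_real A powr (- of_nat n / 2)"
      using A by (simp add: powr_minus inverse_powr powr_of_real[symmetric])
    moreover have "- (of_nat n :: complex) / 2 + (- (of_nat m - of_nat n) / 2) = - of_nat m / 2"
      by (simp add: field_simps)
    ultimately show ?thesis unfolding W_def by (metis powr_add)
  qed
  have summand: "2 ^ n * frakp n ((of_nat m - of_nat k) / 2) (- 2 * of_nat m) 1 / fact (k - n)
            * of_real ((x - 1) ^ n)
            * of_real (\<bar>(1 + x) / (1 - x)\<bar> powr (real n / 2))
            * legendreP (of_nat (k - n)) (of_nat m - of_nat n) x = (\<Sum>j\<le>k-n. T n j)"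
    if n: "n \<le> k" for n
  proof -
    have L: "legendreP (of_nat (k - n)) (of_nat m - of_nat n) x / fact (k - n) =
      of_real A powr (- (of_nat m - of_nat n) / 2) *
      (\<Sum>j\<le>k-n. (- 1) ^ j * of_nat ((k - n + j) choose j) / fact (k - n - j) *
              rGamma (1 - (of_nat m - of_nat n) + of_nat j) * u ^ j)"
      unfolding A_def u_def using assms by (intro legendreP_of_nat) auto
    \<comment> \<open>One factor 2 comes from the sum, the other from \<open>x - 1 = - 2 * u\<close>.\<close>
    have "complex_of_real (x - 1) = 2 * (- u)" by (simp add: u_def field_simps)
    then have xn: "2 ^ n * complex_of_real ((x - 1) ^ n) = 4 ^ n * (- u) ^ n"
      by (simp flip: power_mult_distrib)
    have "2 ^ n * frakp n ((of_nat m - of_nat k) / 2) (- 2 * of_nat m) 1 / fact (k - n)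
            * of_real ((x - 1) ^ n)
            * of_real (\<bar>(1 + x) / (1 - x)\<bar> powr (real n / 2))
            * legendreP (of_nat (k - n)) (of_nat m - of_nat n) x =
          p n * (2 ^ n * complex_of_real ((x - 1) ^ n)) *
          (of_real (\<bar>(1 + x) / (1 - x)\<bar> powr (real n / 2)) *
          (legendreP (of_nat (k - n)) (of_nat m - of_nat n) x / fact (k - n)))"
      unfolding p by simp
    also have "\<dots> = p n * (4 ^ n * (- u) ^ n) * (W *
      (\<Sum>j\<le>k-n. (- 1) ^ j * of_nat ((k - n + j) choose j) / fact (k - n - j) *
              rGamma (1 - (of_nat m - of_nat n) + of_nat j) * u ^ j))"
      unfolding xn L by (simp only: pref mult.assoc[symmetric])
    also have "\<dots> = (\<Sum>j\<le>k-n. T n j)"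
      unfolding sum_distrib_left
    proof (intro sum.cong refl)
      fix j
      have "(- u) ^ j = (- 1) ^ j * u ^ j" by (rule power_minus)
      then show "p n * (4 ^ n * (- u) ^ n) * (W *
          ((- 1) ^ j * of_nat ((k - n + j) choose j) / fact (k - n - j) *
              rGamma (1 - (of_nat m - of_nat n) + of_nat j) * u ^ j)) = T n j"
        by (simp add: T_def power_add algebra_simps)
    qed
    finally show ?thesis .
  qed
  have "(\<Sum>n=0..k. \<Sum>j\<le>k-n. T n j) = (\<Sum>(n, j)\<in>{(n, j). n + j \<le> k}. T n j)"
    by (subst sum.Sigma) (auto intro!: sum.cong)
  also have "\<dots> = (\<Sum>s\<le>k. \<Sum>n\<le>s. T n (s - n))"
    by (rule sum.triangle_reindex_eq)
  also have "\<dots> = 0"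
  proof (rule sum.neutral, rule ballI)
    fix s assume s: "s \<in> {..k}"
    have "(\<Sum>n\<le>s. T n (s - n)) =
        (\<Sum>n\<le>s. 4 ^ n * p n * of_nat ((k - n + (s - n)) choose (s - n))) *
        (W * rGamma (1 - of_nat m + of_nat s) / fact (k - s) * (- u) ^ s)"
      unfolding sum_distrib_right by (intro sum.cong) (auto simp: T_def)
    also have "\<dots> = 0"
    proof (cases "s < m")
      case True
      then have "rGamma (1 - of_nat m + of_nat s :: complex) = 0"
        using rGamma_of_int[of "1 - int m + int s", where ?'a = complex] by simp
      then show ?thesis by simp
    next
      case False
      then have "(\<Sum>n\<le>s. 4 ^ n * p n * of_nat ((k - n + (s - n)) choose (s - n))) = 0"
        unfolding p_def using s assms by (intro frakp_binomial_sum_eq_0) auto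
      then show ?thesis by simp
    qed
    finally show "(\<Sum>n\<le>s. T n (s - n)) = 0" .
  qed
  finally show ?thesis using summand by simp
qed

end
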